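(* Let $q$ be a prime power, $D\subseteq\mathbb{F}_q$ with $|D|=n$, let $\ell\ge 1$ and $k\ge 0$ be integers, let $f\in\mathcal{M}_{k+\ell}$ and let $r\ge 0$ be an integer. Then $$M(f,r)=\mathbf{1}[r\le k]\,q^{k-r}\binom{n}{r}+\frac{\mathbf{1}[k<r\le k+\ell]}{r!}\,\#\Big\{(g,(x_1,\dots,x_r)) : g\in\mathcal{M}_{k+\ell-r},\ (x_1,\dots,x_r)\in\bar X_r,\ g\prod_{j=1}^r(x+x_j)\sim f\Big\},$$ and $$N(f,r)=q^{k-r}\binom{n}{r}\sum_{j=0}^{k-r}(-q)^{-j}\binom{n-r}{j}+\sum_{i=1}^{\ell}(-1)^{k+i-r}\binom{k+i}{r}\frac{1}{(k+i)!}\,\#\Big\{(g,(x_1,\dots,x_{k+i})) : g\in\mathcal{M}_{\ell-i},\ (x_1,\dots,x_{k+i})\in\bar X_{k+i},\ g\prod_{j=1}^{k+i}(x+x_j)\sim f\Big\}.$$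
   Context: $\mathcal{M}_d$ denotes the set of monic polynomials of degree $d$ over $\mathbb{F}_q$. For a monic $h=x^d+h_1x^{d-1}+\dots+h_d$, set $h_i=0$ for $i>d$; its $\ell$ leading coefficients are $(h_1,\dots,h_\ell)$, and $h\sim h'$ means $h,h'$ have the same $\ell$ leading coefficients. $\bar X_m$ is the set of $m$-tuples of pairwise distinct elements of $D$. For $f\in\mathcal{M}_{k+\ell}$: $M(f,r)=\sum_{S\subseteq D,|S|=r}\#\{g\in\mathcal{M}_{k+\ell}: g\sim f,\ \prod_{\alpha\in S}(x+\alpha)\mid g\}$, and $N(f,r)$ is the number of $g\in\mathcal{M}_{k+\ell}$ with $g\sim f$ such that exactly $r$ elements $\alpha\in D$ satisfy $(x+\alpha)\mid g$. $\mathbf{1}[P]$ is $1$ if $P$ holds and $0$ otherwise; binomial coefficients with out-of-range lower index are $0$, and empty sums are $0$. *)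

theory Defs
  imports "HOL-Computational_Algebra.Polynomial" "HOL-Library.Cardinality"
begin

definition monics :: "nat \<Rightarrow> 'a::field poly set" where
  "monics d = {h. degree h = d \<and> lead_coeff h = 1}"

text \<open>For \<open>h = x\<^sup>d + h\<^sub>1 x\<^bsup>d-1\<^esup> + \<dots> + h\<^sub>d\<close> of degree \<open>d\<close>, this is \<open>h\<^sub>i\<close>; the guard is needed
  because \<open>d - i\<close> truncates at \<open>0\<close>.\<close>

definition top_coeff :: "'a::field poly \<Rightarrow> nat \<Rightarrow> 'a" where
  "top_coeff h i = (if i \<le> degree h then coeff h (degree h - i) else 0)"

definition same_top :: "nat \<Rightarrow> 'a::field poly \<Rightarrow> 'a poly \<Rightarrow> bool" where
  "same_top l h h' \<longleftrightarrow> (\<forall>i\<in>{1..l}. top_coeff h i = top_coeff h' i)"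

definition distinct_tuples :: "'a set \<Rightarrow> nat \<Rightarrow> 'a list set" where
  "distinct_tuples D m = {xs. length xs = m \<and> distinct xs \<and> set xs \<subseteq> D}"

definition M_count :: "'a::{field,finite} set \<Rightarrow> nat \<Rightarrow> nat \<Rightarrow> 'a poly \<Rightarrow> nat \<Rightarrow> nat" where
  "M_count D k l f r =
    (\<Sum>S | S \<subseteq> D \<and> card S = r.
       card {g \<in> monics (k + l). same_top l g f \<and> (\<Prod>\<alpha>\<in>S. [:\<alpha>, 1:]) dvd g})"

definition N_count :: "'a::{field,finite} set \<Rightarrow> nat \<Rightarrow> nat \<Rightarrow> 'a poly \<Rightarrow> nat \<Rightarrow> nat" where
  "N_count D k l f r =
    card {g \<in> monics (k + l). same_top l g f \<and> card {\<alpha> \<in> D. [:\<alpha>, 1:] dvd g} = r}"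

end

theory Submission
  imports Defs "HOL-Combinatorics.Multiset_Permutations"
begin

text \<open>A monic \<open>g\<close> of degree \<open>k + l\<close> satisfies \<open>g \<sim> f\<close> iff \<open>g - f\<close> has degree below \<open>k\<close>. Division
  with remainder by a monic \<open>P\<close> of degree \<open>r \<le> k\<close> then parametrises the multiples of \<open>P\<close> with
  \<open>g \<sim> f\<close> by the polynomials of degree below \<open>k - r\<close>, so there are \<open>q\<^bsup>k-r\<^esup>\<close> of them. For \<open>r > k\<close>
  writing \<open>g = h P\<close> and ordering the \<open>r\<close> chosen roots gives the pair count divided by \<open>r!\<close>.
  Finally \<open>M(f,j)\<close> is the sum of \<open>z\<^sub>g choose j\<close> over all \<open>g \<sim> f\<close>, where \<open>z\<^sub>g\<close> is the number of
  \<open>\<alpha> \<in> D\<close> with \<open>x + \<alpha>\<close> dividing \<open>g\<close>, and binomial inversion yields \<open>N(f,r)\<close>.\<close>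

section \<open>Polynomials of bounded degree and the relation \<open>same_top\<close>\<close>

text \<open>Phrased through coefficients so that the zero polynomial belongs for every
  \<open>m\<close>, including \<open>m = 0\<close>, where \<open>degree h < m\<close> would exclude
  it.\<close>

definition polys_below :: "nat \<Rightarrow> 'a::zero poly set" where
  "polys_below m = {h. \<forall>i\<ge>m. coeff h i = 0}"

lemma polys_below_0: "polys_below 0 = {0}"
  by (auto simp: polys_below_def poly_eq_iff)

lemma polys_below_Suc: "polys_below (Suc m) = (\<lambda>(a, h). pCons a h) ` (UNIV \<times> polys_below m)"
proof (intro equalityI subsetI)
  fix p :: "'a poly"
  assume p: "p \<in> polys_below (Suc m)"
  obtain a h where ah: "p = pCons a h" by (cases p)
  have "coeff h i = 0" if "i \<ge> m" for i
    using p that ah by (auto simp: polys_below_def dest!: spec[of _ "Suc i"])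
  then show "p \<in> (\<lambda>(a, h). pCons a h) ` (UNIV \<times> polys_below m)"
    using ah by (auto simp: polys_below_def)
qed (auto simp: polys_below_def coeff_pCons split: nat.splits)

lemma finite_card_polys_below:
  "finite (polys_below m :: 'a::{zero,finite} poly set) \<and>
   card (polys_below m :: 'a poly set) = CARD('a) ^ m"
proof (induction m)
  case 0
  show ?case by (simp add: polys_below_0)
next
  case (Suc m)
  have "inj_on (\<lambda>(a, h). pCons a h) (UNIV \<times> polys_below m :: ('a \<times> 'a poly) set)"
    by (auto simp: inj_on_def)
  with Suc show ?case
    by (simp add: polys_below_Suc card_image card_cartesian_product)
qed

lemma mem_polys_below_iff: "h \<in> polys_below m \<longleftrightarrow> h = 0 \<or> degree h < m"
proof -
  have "degree h < m" if "\<forall>i\<ge>m. coeff h i = 0" "h \<noteq> 0"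
    using that leading_coeff_neq_0 not_less by blast
  then show ?thesis
    by (auto simp: polys_below_def intro: coeff_eq_0)
qed

lemma polys_below_diff:
  "g \<in> polys_below m \<Longrightarrow> h \<in> polys_below m \<Longrightarrow> g - h \<in> polys_below m" for g h :: "'a::ab_group_add poly"
  by (simp add: polys_below_def)

text \<open>In degree \<open>k + l\<close> the coefficient at \<open>k + l - j\<close> is the
  \<open>j\<close>-th top coefficient, so being monic with the same top coefficients means agreeing
  with \<open>f\<close> at every index from \<open>k\<close> on. Conversely, such agreement already
  forces \<open>g\<close> to be monic of degree \<open>k + l\<close>.\<close>

lemma monic_and_same_top_iff:
  assumes "f \<in> monics (k + l)"
  shows "g \<in> monics (k + l) \<and> same_top l g f \<longleftrightarrow> g - f \<in> polys_below k"
proof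
  assume g: "g \<in> monics (k + l) \<and> same_top l g f"
  have "coeff (g - f) i = 0" if "i \<ge> k" for i
  proof -
    consider "i > k + l" | "i = k + l" | "i < k + l" by linarith
    then show ?thesis
    proof cases
      case 1
      then show ?thesis using g assms by (simp add: monics_def coeff_eq_0)
    next
      case 2
      then show ?thesis using g assms by (auto simp: monics_def)
    next
      case 3
      define j where "j = k + l - i"
      have j: "j \<in> {1..l}" "k + l - j = i" "j \<le> k + l" using 3 that by (auto simp: j_def)
      then have "top_coeff g j = top_coeff f j" using g by (simp add: same_top_def)
      then show ?thesis using g assms j by (simp add: top_coeff_def monics_def)
    qed
  qed
  then show "g - f \<in> polys_below k" by (simp add: polys_below_def)
next
  assume "g - f \<in> polys_below k"
  then have eq: "coeff g i = coeff f i" if "i \<ge> k" for i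
    using that by (auto simp: polys_below_def)
  have "degree g \<le> k + l"
    using eq assms by (intro degree_le) (auto simp: monics_def coeff_eq_0)
  moreover have "coeff g (k + l) = 1" using eq assms by (auto simp: monics_def)
  ultimately have "degree g = k + l" by (intro antisym le_degree) auto
  then show "g \<in> monics (k + l) \<and> same_top l g f"
    using eq assms \<open>coeff g (k + l) = 1\<close>
    by (auto simp: monics_def same_top_def top_coeff_def)
qed

lemma finite_monics: "finite (monics d :: 'a::{field,finite} poly set)"
proof (rule finite_subset)
  show "monics d \<subseteq> (polys_below (Suc d) :: 'a poly set)"
    by (auto simp: monics_def mem_polys_below_iff)
qed (simp add: finite_card_polys_below)

lemma card_same_top_multiples:
  fixes f P :: "'a::{field,finite} poly"
  assumes f: "f \<in> monics (k + l)" and P: "P \<in> monics r" and "r \<le> k"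
  shows "card {g \<in> monics (k + l). same_top l g f \<and> P dvd g} = CARD('a) ^ (k - r)"
proof -
  have P0: "P \<noteq> 0" "degree P = r" using P by (auto simp: monics_def)
  \<comment> \<open>The solutions form a coset: \<open>f - b\<close> is a multiple of
    \<open>P\<close>, and it is one of them because \<open>b\<close> has degree below
    \<open>r\<close> and \<open>r \<le> k\<close>. Any other differs from it by a multiple of
    \<open>P\<close> in \<open>polys_below k\<close>.\<close>
  define b where "b = f mod P"
  have b: "b \<in> polys_below k"
    using degree_mod_less[of P f] P0 \<open>r \<le> k\<close> by (auto simp: b_def mem_polys_below_iff)
  have fb: "P dvd f - b" by (simp add: b_def minus_mod_eq_mult_div)
  have mult: "P * u \<in> polys_below k \<longleftrightarrow> u \<in> polys_below (k - r)" for u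
    using P0 \<open>r \<le> k\<close> by (cases "u = 0") (auto simp: mem_polys_below_iff degree_mult_eq)
  have "{g \<in> monics (k + l). same_top l g f \<and> P dvd g} = {g. g - f \<in> polys_below k \<and> P dvd g}"
    using monic_and_same_top_iff[OF f] by blast
  also have "\<dots> = (\<lambda>u. f - b + P * u) ` polys_below (k - r)"
  proof (intro equalityI subsetI)
    fix g assume "g \<in> {g. g - f \<in> polys_below k \<and> P dvd g}"
    then have g: "g - f \<in> polys_below k" "P dvd g - (f - b)" using fb by auto
    from g(2) obtain u where u: "g - (f - b) = P * u" ..
    have "P * u = (g - f) - (0 - b)" by (simp flip: u)
    also have "\<dots> \<in> polys_below k"
      by (intro polys_below_diff g(1) b) (simp add: mem_polys_below_iff)
    finally show "g \<in> (\<lambda>u. f - b + P * u) ` polys_below (k - r)"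
      using u mult by (intro image_eqI[of _ _ u]) (auto simp: algebra_simps)
  next
    fix g assume "g \<in> (\<lambda>u. f - b + P * u) ` polys_below (k - r)"
    then obtain u where u: "u \<in> polys_below (k - r)" "g = f - b + P * u" by blast
    have "P * u - b \<in> polys_below k" using u b mult by (intro polys_below_diff) auto
    then show "g \<in> {g. g - f \<in> polys_below k \<and> P dvd g}" using u fb by auto
  qed
  also have "card \<dots> = CARD('a) ^ (k - r)"
    using P0 by (subst card_image) (auto simp: inj_on_def finite_card_polys_below)
  finally show ?thesis .
qed

section \<open>Products of distinct linear factors\<close>

lemma prod_linear_monic: "(\<Prod>\<alpha>\<in>S. [:\<alpha>, 1:]) \<in> monics (card S)" for S :: "'a::field set"
proof -
  have "degree (\<Prod>\<alpha>\<in>S. [:\<alpha>, 1:]) = card S"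
    by (subst degree_prod_eq_sum_degree) auto
  moreover have "lead_coeff (\<Prod>\<alpha>\<in>S. [:\<alpha>, 1:]) = 1" by (simp add: lead_coeff_prod)
  ultimately show ?thesis by (simp add: monics_def)
qed

text \<open>Induction on \<open>S\<close>: after splitting off x + a, every other \<alpha> in
  \<open>S\<close> gives a root -\<alpha> of \<open>g\<close> at which x + a does not vanish, hence
  a root of the cofactor.\<close>

lemma prod_linear_dvd_iff:
  fixes S :: "'a::field set"
  assumes "finite S"
  shows "(\<Prod>\<alpha>\<in>S. [:\<alpha>, 1:]) dvd g \<longleftrightarrow> (\<forall>\<alpha>\<in>S. [:\<alpha>, 1:] dvd g)"
proof
  assume "(\<Prod>\<alpha>\<in>S. [:\<alpha>, 1:]) dvd g"
  then show "\<forall>\<alpha>\<in>S. [:\<alpha>, 1:] dvd g"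
    using assms by (meson dvd_prodI dvd_trans)
next
  assume "\<forall>\<alpha>\<in>S. [:\<alpha>, 1:] dvd g"
  with assms show "(\<Prod>\<alpha>\<in>S. [:\<alpha>, 1:]) dvd g"
  proof (induction S arbitrary: g rule: finite_induct)
    case (insert a S)
    then obtain h where h: "g = [:a, 1:] * h" by (auto elim: dvdE)
    have "[:\<alpha>, 1:] dvd h" if "\<alpha> \<in> S" for \<alpha>
    proof -
      have "poly g (- \<alpha>) = 0" using insert that dvd_iff_poly_eq_0[of "\<alpha>" g] by auto
      moreover have "\<alpha> \<noteq> a" using insert that by auto
      ultimately show ?thesis using dvd_iff_poly_eq_0[of "\<alpha>" h] h by auto
    qed
    then have "(\<Prod>\<alpha>\<in>S. [:\<alpha>, 1:]) dvd h" using insert.IH by blast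
    then show ?case
      using insert h by (simp del: mult_pCons_left mult_pCons_right)
  qed simp
qed

text \<open>The product of all these factors divides \<open>g\<close>, so its degree is at most
  \<open>d\<close>. This bound lets the inversion stop at \<open>k + l\<close> and makes M vanish
  beyond it.\<close>

lemma card_linear_divisors_le:
  fixes g :: "'a::field poly"
  assumes "g \<in> monics d" "finite D"
  shows "card {\<alpha> \<in> D. [:\<alpha>, 1:] dvd g} \<le> d"
proof -
  let ?Z = "{\<alpha> \<in> D. [:\<alpha>, 1:] dvd g}"
  have "(\<Prod>\<alpha>\<in>?Z. [:\<alpha>, 1:]) dvd g" using assms by (subst prod_linear_dvd_iff) auto
  moreover have "g \<noteq> 0" using assms by (auto simp: monics_def)
  ultimately have "degree (\<Prod>\<alpha>\<in>?Z. [:\<alpha>, 1:]) \<le> degree g" by (rule dvd_imp_degree_le)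
  then show ?thesis using prod_linear_monic[of ?Z] assms by (auto simp: monics_def)
qed

section \<open>Evaluations of M\<close>

lemma M_count_eq_power:
  fixes f :: "'a::{field,finite} poly"
  assumes "f \<in> monics (k + l)" "r \<le> k"
  shows "M_count D k l f r = CARD('a) ^ (k - r) * (card D choose r)"
proof -
  have "card {g \<in> monics (k + l). same_top l g f \<and> (\<Prod>\<alpha>\<in>S. [:\<alpha>, 1:]) dvd g} = CARD('a) ^ (k - r)"
    if "card S = r" for S
    using card_same_top_multiples[OF assms(1) prod_linear_monic] that assms(2) by auto
  then have "M_count D k l f r = (\<Sum>S | S \<subseteq> D \<and> card S = r. CARD('a) ^ (k - r))"
    unfolding M_count_def by (intro sum.cong) auto
  then show ?thesis by (simp add: n_subsets)
qed

text \<open>Double counting of the pairs \<open>(S, g)\<close>: for fixed \<open>g\<close> the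
  admissible \<open>S\<close> are the \<open>j\<close>-subsets of the set of \<alpha> in
  \<open>D\<close> with x + \<alpha> dividing \<open>g\<close>. Cardinalities become sums of
  indicators so that the two sums can be exchanged.\<close>

lemma M_count_eq_sum_choose:
  "M_count D k l f j =
     (\<Sum>g | g \<in> monics (k + l) \<and> same_top l g f. card {\<alpha> \<in> D. [:\<alpha>, 1:] dvd g} choose j)"
proof -
  let ?G = "{g \<in> monics (k + l). same_top l g f}"
  have fin: "finite ?G" by (simp add: finite_monics)
  have "M_count D k l f j =
      (\<Sum>S | S \<subseteq> D \<and> card S = j. \<Sum>g\<in>?G. of_bool ((\<Prod>\<alpha>\<in>S. [:\<alpha>, 1:]) dvd g))"
    unfolding M_count_def using fin
    by (intro sum.cong refl) (auto intro!: arg_cong[of _ _ card] simp: conj_assoc)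
  also have "\<dots> = (\<Sum>g\<in>?G. \<Sum>S | S \<subseteq> D \<and> card S = j. of_bool ((\<Prod>\<alpha>\<in>S. [:\<alpha>, 1:]) dvd g))"
    by (rule sum.swap)
  also have "\<dots> = (\<Sum>g\<in>?G. card {\<alpha> \<in> D. [:\<alpha>, 1:] dvd g} choose j)"
  proof (rule sum.cong[OF refl])
    fix g
    have "(\<Sum>S | S \<subseteq> D \<and> card S = j. of_bool ((\<Prod>\<alpha>\<in>S. [:\<alpha>, 1:]) dvd g)) =
        card {S. S \<subseteq> {\<alpha> \<in> D. [:\<alpha>, 1:] dvd g} \<and> card S = j}"
      by (auto simp: prod_linear_dvd_iff intro!: arg_cong[of _ _ card])
    then show "(\<Sum>S | S \<subseteq> D \<and> card S = j. of_bool ((\<Prod>\<alpha>\<in>S. [:\<alpha>, 1:]) dvd g)) =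
        (card {\<alpha> \<in> D. [:\<alpha>, 1:] dvd g} choose j)"
      by (simp add: n_subsets)
  qed
  finally show ?thesis .
qed

lemma M_count_eq_0:
  assumes "k + l < r"
  shows "M_count D k l f r = 0"
  unfolding M_count_eq_sum_choose
  using assms card_linear_divisors_le[of _ "k + l" D]
  by (intro sum.neutral ballI binomial_eq_0) (force intro: le_less_trans)

text \<open>Degrees add and leading coefficients multiply, so the cofactor is monic of complementary
  degree; \<open>r \<le> m\<close> keeps \<open>m - r\<close> from truncating.\<close>

lemma monic_multiples_eq:
  fixes P :: "'a::field poly"
  assumes P: "P \<in> monics r" and "r \<le> m"
  shows "{g \<in> monics m. P dvd g} = (\<lambda>h. h * P) ` monics (m - r)"
proof -
  have P0: "P \<noteq> 0" "degree P = r" "lead_coeff P = 1" using P by (auto simp: monics_def)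
  have "h * P \<in> monics m \<longleftrightarrow> h \<in> monics (m - r)" for h
    using P0 \<open>r \<le> m\<close> lead_coeff_mult[of h P]
    by (cases "h = 0") (auto simp: monics_def degree_mult_eq)
  then show ?thesis by (auto simp: dvd_def mult.commute image_iff)
qed

text \<open>The product depends only on the set of entries of \<open>xs\<close>, and each
  \<open>r\<close>-subset of \<open>D\<close> has r! orderings. For a fixed subset, multiplication
  by its product is a bijection from the cofactors to the multiples counted by M.\<close>

lemma card_pairs_eq_fact_mult_M_count:
  fixes f :: "'a::{field,finite} poly"
  assumes "r \<le> k + l"
  shows "card {(g, xs). g \<in> monics (k + l - r) \<and> xs \<in> distinct_tuples D r \<and>
                 same_top l (g * (\<Prod>j<r. [:xs ! j, 1:])) f} = fact r * M_count D k l f r"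
proof -
  let ?P = "\<lambda>S::'a set. \<Prod>\<alpha>\<in>S. [:\<alpha>, 1:]"
  let ?H = "\<lambda>S. {h \<in> monics (k + l - r). same_top l (h * ?P S) f}"
  let ?Ss = "{S. S \<subseteq> D \<and> card S = r}"
  have prod_nth: "(\<Prod>j<r. [:xs ! j, 1:]) = ?P (set xs)"
    if "xs \<in> distinct_tuples D r" for xs
  proof -
    have "bij_betw ((!) xs) {..<r} (set xs)"
      using that by (auto simp: distinct_tuples_def intro: bij_betw_nth)
    from prod.reindex_bij_betw[OF this, of "\<lambda>\<alpha>. [:\<alpha>, 1:]"] show ?thesis .
  qed
  have tuples: "xs \<in> distinct_tuples D r \<longleftrightarrow> (\<exists>S\<in>?Ss. xs \<in> permutations_of_set S)" for xs
    by (auto simp: distinct_tuples_def permutations_of_set_def distinct_card)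
  have "{(g, xs). g \<in> monics (k + l - r) \<and> xs \<in> distinct_tuples D r \<and>
          same_top l (g * (\<Prod>j<r. [:xs ! j, 1:])) f} = (\<Union>S\<in>?Ss. ?H S \<times> permutations_of_set S)"
    (is "?A = ?B")
  proof -
    have "?A = {(g, xs). g \<in> monics (k + l - r) \<and> xs \<in> distinct_tuples D r \<and>
          same_top l (g * ?P (set xs)) f}"
      using prod_nth by auto
    also have "\<dots> = ?B"
      by (auto simp: tuples permutations_of_set_def)
    finally show ?thesis .
  qed
  \<comment> \<open>The union is disjoint because \<open>xs\<close> determines \<open>S\<close> as
    its set of entries.\<close>
  also have "card \<dots> = (\<Sum>S\<in>?Ss. card (?H S \<times> permutations_of_set S))"
  proof (rule card_UN_disjoint)
    show "\<forall>S\<in>?Ss. finite (?H S \<times> permutations_of_set S)"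
      by (simp add: finite_monics)
    show "\<forall>S\<in>?Ss. \<forall>T\<in>?Ss. S \<noteq> T \<longrightarrow>
        (?H S \<times> permutations_of_set S) \<inter> (?H T \<times> permutations_of_set T) = {}"
      by (auto simp: permutations_of_set_def)
  qed simp
  also have "\<dots> = (\<Sum>S\<in>?Ss. fact r * card {g \<in> monics (k + l). same_top l g f \<and> ?P S dvd g})"
  proof (rule sum.cong[OF refl])
    fix S assume S: "S \<in> ?Ss"
    then have P: "?P S \<in> monics r" using prod_linear_monic[of S] by auto
    have "{g \<in> monics (k + l). same_top l g f \<and> ?P S dvd g} =
        {g \<in> {g \<in> monics (k + l). ?P S dvd g}. same_top l g f}"
      by auto
    also have "\<dots> = (\<lambda>h. h * ?P S) ` ?H S"
      unfolding monic_multiples_eq[OF P assms] by auto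
    finally have "{g \<in> monics (k + l). same_top l g f \<and> ?P S dvd g} = (\<lambda>h. h * ?P S) ` ?H S" .
    moreover have "?P S \<noteq> 0" by simp
    then have "inj_on (\<lambda>h. h * ?P S) (?H S)"
      by (auto intro!: inj_onI)
    ultimately have "card {g \<in> monics (k + l). same_top l g f \<and> ?P S dvd g} = card (?H S)"
      by (simp add: card_image)
    then show "card (?H S \<times> permutations_of_set S) =
        fact r * card {g \<in> monics (k + l). same_top l g f \<and> ?P S dvd g}"
      using S by (simp add: card_cartesian_product)
  qed
  also have "\<dots> = fact r * M_count D k l f r"
    by (simp add: M_count_def sum_distrib_left)
  finally show ?thesis .
qed

section \<open>Binomial inversion\<close>

text \<open>Trinomial revision followed by the index shift \<open>j\<close> to \<open>j + r\<close>.
  The weight \<open>w\<close> serves two uses: \<open>w = 1\<close> for the inversion, and powers of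
  q for the explicit part of N. The exponent \<open>j + r\<close> has the parity of j - r without
  truncation.\<close>

lemma alternating_choose_choose_sum:
  fixes w :: "nat \<Rightarrow> 'b::comm_ring_1"
  assumes "r \<le> m"
  shows "(\<Sum>j\<le>m. (-1) ^ (j + r) * of_nat (j choose r) * of_nat (z choose j) * w j) =
         of_nat (z choose r) * (\<Sum>j\<le>m - r. (-1) ^ j * of_nat ((z - r) choose j) * w (j + r))"
proof -
  have choose: "(j + r choose r) * (z choose (j + r)) = (z choose r) * ((z - r) choose j)" for j
  proof (cases "j + r \<le> z")
    case True
    then show ?thesis using choose_mult[of r "j + r" z] by (simp add: mult.commute)
  next
    case False
    \<comment> \<open>If \<open>z < r\<close>, then \<open>z - r\<close> truncates to 0 and the
      second factor may be 1, so the first one must vanish.\<close>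
    then have "(z choose r) * ((z - r) choose j) = 0" by (cases "z < r") auto
    then show ?thesis using False by (simp only: not_le binomial_eq_0 mult_0_right)
  qed
  have "(\<Sum>j\<le>m. (-1) ^ (j + r) * of_nat (j choose r) * of_nat (z choose j) * w j) =
      (\<Sum>j\<in>{r..m}. (-1) ^ (j + r) * of_nat (j choose r) * of_nat (z choose j) * w j)"
    by (rule sum.mono_neutral_right) (auto simp: not_le binomial_eq_0)
  also have "\<dots> = (\<Sum>j\<le>m - r. (-1) ^ (j + r + r) * of_nat (j + r choose r)
      * of_nat (z choose (j + r)) * w (j + r))"
    using assms
    by (intro sum.reindex_bij_witness[of _ "\<lambda>j. j + r" "\<lambda>j. j - r"]) auto
  also have "\<dots> = (\<Sum>j\<le>m - r. of_nat (z choose r) *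
      ((-1) ^ j * of_nat ((z - r) choose j) * w (j + r)))"
  proof (rule sum.cong[OF refl])
    fix j
    have "(-1) ^ (j + r + r) * of_nat (j + r choose r) * of_nat (z choose (j + r)) * w (j + r) =
        (-1) ^ j * of_nat ((j + r choose r) * (z choose (j + r))) * w (j + r)"
      by (simp add: power_add mult.assoc flip: power_mult_distrib)
    also have "\<dots> = of_nat (z choose r) * ((-1) ^ j * of_nat ((z - r) choose j) * w (j + r))"
      unfolding choose by (simp add: algebra_simps)
    finally show "(-1) ^ (j + r + r) * of_nat (j + r choose r) * of_nat (z choose (j + r)) * w (j + r)
      = of_nat (z choose r) * ((-1) ^ j * of_nat ((z - r) choose j) * w (j + r))" .
  qed
  finally show ?thesis by (simp add: sum_distrib_left)
qed

text \<open>For \<open>r \<le> z\<close> the remaining alternating sum is the expansion of (1 -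
  1)^(z - r), which is zero unless \<open>z = r\<close>.\<close>

lemma binomial_inversion_delta:
  assumes "z \<le> m"
  shows "(\<Sum>j\<le>m. (-1) ^ (j + r) * of_nat (j choose r) * of_nat (z choose j)) =
         (of_bool (z = r) :: 'b::comm_ring_1)"
proof (cases "r \<le> z")
  case False
  \<comment> \<open>As \<open>z < r\<close>, every \<open>j\<close> satisfies \<open>j < r\<close>
    or \<open>j > z\<close>, and one of the two binomials is zero.\<close>
  have "(-1) ^ (j + r) * of_nat (j choose r) * of_nat (z choose j) = (0::'b)" for j
    using False by (cases "j < r") (auto simp: binomial_eq_0)
  then show ?thesis using False by simp
next
  case True
  have "(\<Sum>j\<le>m. (-1) ^ (j + r) * of_nat (j choose r) * of_nat (z choose j) :: 'b) =
      of_nat (z choose r) * (\<Sum>j\<le>m - r. (-1) ^ j * of_nat ((z - r) choose j))"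
    using alternating_choose_choose_sum[of r m z "\<lambda>_. 1 :: 'b"] True assms by simp
  also have "(\<Sum>j\<le>m - r. (-1) ^ j * of_nat ((z - r) choose j) :: 'b) =
      (\<Sum>j\<le>z - r. (-1) ^ j * of_nat ((z - r) choose j))"
    using assms by (intro sum.mono_neutral_right) (auto simp: not_le binomial_eq_0)
  also have "of_nat (z choose r) * \<dots> = of_bool (z = r)"
    using choose_alternating_sum[of "z - r", where ?'a = 'b] True by (cases "z = r") auto
  finally show ?thesis .
qed

text \<open>The indicator of having exactly \<open>r\<close> linear divisors is expanded by the
  delta identity; after exchanging sums, the inner sum over \<open>g\<close> is M.\<close>

lemma N_count_eq_alternating_sum:
  "of_nat (N_count D k l f r) =
     (\<Sum>j\<le>k + l. (-1) ^ (j + r) * of_nat (j choose r) * of_nat (M_count D k l f j) :: 'b::comm_ring_1)"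
proof -
  let ?G = "{g \<in> monics (k + l). same_top l g f}"
  let ?z = "\<lambda>g. card {\<alpha> \<in> D. [:\<alpha>, 1:] dvd g}"
  have fin: "finite ?G" by (simp add: finite_monics)
  have "(of_nat (N_count D k l f r) :: 'b) = of_nat (\<Sum>g\<in>?G. of_bool (?z g = r))"
    unfolding N_count_def using fin
    by (intro arg_cong[of _ _ of_nat]) (auto intro!: arg_cong[of _ _ card])
  also have "\<dots> = (\<Sum>g\<in>?G. of_bool (?z g = r))" by simp
  also have "\<dots> = (\<Sum>g\<in>?G. \<Sum>j\<le>k + l. (-1) ^ (j + r) * of_nat (j choose r) * of_nat (?z g choose j))"
    by (intro sum.cong refl binomial_inversion_delta[symmetric] card_linear_divisors_le) auto
  also have "\<dots> = (\<Sum>j\<le>k + l. \<Sum>g\<in>?G. (-1) ^ (j + r) * of_nat (j choose r) * of_nat (?z g choose j))"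
    by (rule sum.swap)
  also have "\<dots> = (\<Sum>j\<le>k + l. (-1) ^ (j + r) * of_nat (j choose r) * of_nat (M_count D k l f j))"
    by (simp add: M_count_eq_sum_choose sum_distrib_left)
  finally show ?thesis .
qed

text \<open>Translates the integer-exponent sign of the final formula into the sign produced by the
  inversion.\<close>

lemma minus_one_powi_diff: "(-1) powi (int a - int b) = ((-1) ^ (a + b) :: 'b::field)"
  by (simp add: power_int_diff power_add power_int_minus field_simps flip: power_mult_distrib)

section \<open>The closed formulas for M and N\<close>

text \<open>The range of \<open>j\<close> in the formula for N is one of integers so that it is
  empty for \<open>r > k\<close>; truncated subtraction would leave the term
  \<open>j = 0\<close>.\<close>

theorem theorem1:
  fixes D :: "'a::{field,finite} set"
    and f :: "'a poly"
    and q n k l r :: nat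
  assumes "q = CARD('a)"
    and "card D = n"
    and "l \<ge> 1"
    and "f \<in> monics (k + l)"
  shows "((of_nat (M_count D k l f r) :: rat) =
           of_bool (r \<le> k) * of_nat q powi (int k - int r) * of_nat (n choose r)
         + of_bool (k < r \<and> r \<le> k + l) / fact r *
             of_nat (card {(g, xs). g \<in> monics (k + l - r) \<and> xs \<in> distinct_tuples D r \<and>
                             same_top l (g * (\<Prod>j<r. [:xs ! j, 1:])) f}))
       \<and> ((of_nat (N_count D k l f r) :: rat) =
           of_nat q powi (int k - int r) * of_nat (n choose r) *
             (\<Sum>j\<in>{0..int k - int r}. (- of_nat q) powi (- j) * of_nat ((n - r) choose nat j))
         + (\<Sum>i=1..l. (-1) powi (int k + int i - int r) * of_nat ((k + i) choose r) *
              (1 / fact (k + i)) *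
              of_nat (card {(g, xs). g \<in> monics (l - i) \<and> xs \<in> distinct_tuples D (k + i) \<and>
                              same_top l (g * (\<Prod>j<k + i. [:xs ! j, 1:])) f})))"
proof
  let ?pairs = "\<lambda>m r. card {(g, xs). g \<in> monics m \<and> xs \<in> distinct_tuples D r \<and>
                   same_top l (g * (\<Prod>j<r. [:xs ! j, 1:])) f}"
  let ?M = "M_count D k l f"
  have q0: "(of_nat q :: rat) \<noteq> 0" using assms(1) by simp
  have small: "(of_nat (?M j) :: rat) = of_nat q ^ (k - j) * of_nat (n choose j)" if "j \<le> k" for j
    using M_count_eq_power[OF assms(4) that, of D] assms by simp
  have pairs: "of_nat (?pairs (k + l - j) j) = fact j * (of_nat (?M j) :: rat)" if "j \<le> k + l" for j
    using card_pairs_eq_fact_mult_M_count[OF that, of D f] by simp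
  have qpow: "of_nat q powi (int k - int j) = (of_nat q ^ (k - j) :: rat)" if "j \<le> k" for j
    using that by (simp add: power_int_def nat_diff_distrib)
  consider "r \<le> k" | "k < r" "r \<le> k + l" | "k + l < r" by linarith
  then show "(of_nat (?M r) :: rat) =
           of_bool (r \<le> k) * of_nat q powi (int k - int r) * of_nat (n choose r)
         + of_bool (k < r \<and> r \<le> k + l) / fact r * of_nat (?pairs (k + l - r) r)"
  proof cases
    case 1
    then show ?thesis using small qpow by simp
  next
    case 2
    then show ?thesis using pairs by simp
  next
    case 3
    then show ?thesis by (simp add: M_count_eq_0)
  qed

  let ?t = "\<lambda>j. (-1) ^ (j + r) * of_nat (j choose r) * of_nat (?M j) :: rat"
  have "of_nat (N_count D k l f r) = sum ?t {..k + l}"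
    by (rule N_count_eq_alternating_sum)
  \<comment> \<open>Up to \<open>k\<close> the values of M are explicit; above \<open>k\<close> they
    are replaced by pair counts divided by factorials.\<close>
  also have "{..k + l} = {..k} \<union> {k + 1..k + l}" by auto
  also have "sum ?t \<dots> = sum ?t {..k} + sum ?t {k + 1..k + l}"
    by (rule sum.union_disjoint) auto
  also have "sum ?t {k + 1..k + l} = (\<Sum>i=1..l. ?t (k + i))"
    by (rule sum.reindex_bij_witness[of _ "\<lambda>i. k + i" "\<lambda>j. j - k"]) auto
  also have "\<dots> = (\<Sum>i=1..l. (-1) powi (int k + int i - int r) * of_nat ((k + i) choose r) *
              (1 / fact (k + i)) * of_nat (?pairs (l - i) (k + i)))"
  proof (rule sum.cong[OF refl])
    fix i assume "i \<in> {1..l}"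
    then show "?t (k + i) = (-1) powi (int k + int i - int r) * of_nat ((k + i) choose r) *
              (1 / fact (k + i)) * of_nat (?pairs (l - i) (k + i))"
      using pairs[of "k + i"] minus_one_powi_diff[of "k + i" r, where ?'b = rat] by simp
  qed
  also have "sum ?t {..k} = of_nat q powi (int k - int r) * of_nat (n choose r) *
      (\<Sum>j\<in>{0..int k - int r}. (- of_nat q) powi (- j) * of_nat ((n - r) choose nat j))"
  proof (cases "r \<le> k")
    case False
    \<comment> \<open>Here \<open>j \<le> k < r\<close> makes \<open>j choose r\<close> zero,
      matching the empty integer range.\<close>
    then have "sum ?t {..k} = 0" by (intro sum.neutral) auto
    then show ?thesis using False by simp
  next
    case True
    have "sum ?t {..k} = (\<Sum>j\<le>k. (-1) ^ (j + r) * of_nat (j choose r) * of_nat (n choose j) *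
        of_nat q ^ (k - j))"
      using small by (intro sum.cong) auto
    also have "\<dots> = of_nat (n choose r) *
        (\<Sum>j\<le>k - r. (-1) ^ j * of_nat ((n - r) choose j) * of_nat q ^ (k - (j + r)))"
      \<comment> \<open>Applied with \<open>z = n\<close>, \<open>m = k\<close> and the weight q^(k
        - j).\<close>
      by (rule alternating_choose_choose_sum[OF True])
    also have "(\<Sum>j\<le>k - r. (-1) ^ j * of_nat ((n - r) choose j) * of_nat q ^ (k - (j + r))) =
        (\<Sum>j\<in>{0..int k - int r}. of_nat q powi (int k - int r) *
          ((- of_nat q) powi (- j) * of_nat ((n - r) choose nat j)) :: rat)"
    proof (rule sum.reindex_bij_witness[of _ nat int])
      fix j assume "j \<in> {..k - r}"
      then have j: "j + r \<le> k" using True by auto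
      \<comment> \<open>Pulling out q^(k - r) leaves q^(-j), which absorbs the sign (-1)^j into
        (-q)^(-j).\<close>
      have "(of_nat q :: rat) ^ (k - r) = of_nat q ^ (k - (j + r)) * of_nat q ^ j"
        using j by (simp flip: power_add)
      moreover have "(- of_nat q :: rat) powi (- int j) = (-1) ^ j / of_nat q ^ j"
        by (cases "even j") (auto simp: power_int_minus field_simps)
      ultimately show "of_nat q powi (int k - int r) *
          ((- of_nat q) powi (- int j) * of_nat ((n - r) choose nat (int j))) =
          (-1) ^ j * of_nat ((n - r) choose j) * (of_nat q :: rat) ^ (k - (j + r))"
        using qpow[OF True] q0 by simp
    qed (use True in auto)
    finally show ?thesis by (simp add: sum_distrib_left mult_ac)
  qed
  finally show "(of_nat (N_count D k l f r) :: rat) =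
           of_nat q powi (int k - int r) * of_nat (n choose r) *
             (\<Sum>j\<in>{0..int k - int r}. (- of_nat q) powi (- j) * of_nat ((n - r) choose nat j))
         + (\<Sum>i=1..l. (-1) powi (int k + int i - int r) * of_nat ((k + i) choose r) *
              (1 / fact (k + i)) * of_nat (?pairs (l - i) (k + i)))" .
qed

end
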